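(* For every countable family $\mathcal{P}$ of metrizable compacta, the class of all $\mathcal{P}$-like spaces is compactifiable.
   Context: A metrizable compactum is a compact metrizable space; the empty space is allowed. An inverse sequence consists of topological spaces $X_n$ and continuous bonding maps $f_n\colon X_{n+1}\to X_n$, $n\in\omega$; its limit is the subspace of $\prod_n X_n$ of all $(x_n)_n$ with $x_n=f_n(x_{n+1})$ for every $n$. A topological space is $\mathcal{P}$-like if it is (homeomorphic to) the limit of an inverse sequence all of whose bonding maps are continuous surjections between spaces from $\mathcal{P}$. Two classes $\mathcal{C},\mathcal{D}$ of topological spaces are equivalent, written $\mathcal{C}\cong\mathcal{D}$, if every space in $\mathcal{C}$ is homeomorphic to a space in $\mathcal{D}$ and vice versa. A class $\mathcal{C}$ is compactifiable if there is a continuous (not necessarily surjective) map $q\colon A\to B$ between metrizable compacta such that $\{q^{-1}(b): b\in B\}\cong\mathcal{C}$, where the fibers carry the subspace topology. *)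

theory Defs
  imports "HOL-Analysis.Analysis"
begin

definition metrizable_compactum :: "'a topology \<Rightarrow> bool" where
  "metrizable_compactum X \<longleftrightarrow> compact_space X \<and> metrizable_space X"

definition inverse_sequence :: "(nat \<Rightarrow> 'a topology) \<Rightarrow> (nat \<Rightarrow> 'a \<Rightarrow> 'a) \<Rightarrow> bool" where
  "inverse_sequence X f \<longleftrightarrow> (\<forall>n. continuous_map (X (Suc n)) (X n) (f n))"

definition inverse_limit :: "(nat \<Rightarrow> 'a topology) \<Rightarrow> (nat \<Rightarrow> 'a \<Rightarrow> 'a) \<Rightarrow> (nat \<Rightarrow> 'a) topology" where
  "inverse_limit X f =
     subtopology (product_topology X UNIV) {x. \<forall>n. x n = f n (x (Suc n))}"

definition P_like :: "'a topology set \<Rightarrow> 'b topology \<Rightarrow> bool" where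
  "P_like P Y \<longleftrightarrow>
     (\<exists>X f. inverse_sequence X f \<and>
        (\<forall>n. X n \<in> P) \<and>
        (\<forall>n. f n ` topspace (X (Suc n)) = topspace (X n)) \<and>
        Y homeomorphic_space inverse_limit X f)"

definition equivalent_classes :: "'a topology set \<Rightarrow> 'b topology set \<Rightarrow> bool" where
  "equivalent_classes C D \<longleftrightarrow>
     (\<forall>X\<in>C. \<exists>Y\<in>D. X homeomorphic_space Y) \<and> (\<forall>Y\<in>D. \<exists>X\<in>C. Y homeomorphic_space X)"

definition fibers :: "'a topology \<Rightarrow> 'b topology \<Rightarrow> ('a \<Rightarrow> 'b) \<Rightarrow> 'a topology set" where
  "fibers A B q = (\<lambda>b. subtopology A {a \<in> topspace A. q a = b}) ` topspace B"

text \<open>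
  The existential quantifier over the spaces \<open>A\<close> and \<open>B\<close> needs a concrete carrier type.
  They are arbitrary topologies, with arbitrary underlying sets, on the type \<open>nat \<Rightarrow> real\<close>.
  This is no restriction, since a metrizable compactum has at most continuum many points;
  see \<open>metrizable_compactum_copy\<close> and \<open>compactifiableI\<close> below.
\<close>

definition compactifiable :: "'c topology set \<Rightarrow> bool" where
  "compactifiable C \<longleftrightarrow>
     (\<exists>(A :: (nat \<Rightarrow> real) topology) (B :: (nat \<Rightarrow> real) topology) q.
        metrizable_compactum A \<and> metrizable_compactum B \<and> continuous_map A B q \<and>
        equivalent_classes (fibers A B q) C)"

text \<open>
  A set of topologies can only contain spaces over one type. The class of all \<open>P\<close>-like spaces is
  taken over the type in which the inverse limits themselves live, so that it contains a
  homeomorphic copy of every \<open>P\<close>-like space over any type; see \<open>P_like_copy\<close> below.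
\<close>

definition P_like_spaces :: "'a topology set \<Rightarrow> (nat \<Rightarrow> 'a) topology set" where
  "P_like_spaces P = {Y. P_like P Y}"

lemma P_like_copy:
  fixes P :: "'a topology set" and Y :: "'b topology"
  shows "P_like P Y \<longleftrightarrow> (\<exists>Z \<in> P_like_spaces P. Y homeomorphic_space Z)"
proof
  assume "P_like P Y"
  then show "\<exists>Z \<in> P_like_spaces P. Y homeomorphic_space Z"
    unfolding P_like_spaces_def P_like_def using homeomorphic_space_refl by blast
next
  assume "\<exists>Z \<in> P_like_spaces P. Y homeomorphic_space Z"
  then show "P_like P Y"
    unfolding P_like_spaces_def P_like_def using homeomorphic_space_trans by blast
qed

lemma metrizable_compactum_copy:
  fixes X :: "'a topology"
  assumes "metrizable_compactum X"
  shows "\<exists>Y :: (nat \<Rightarrow> real) topology. X homeomorphic_space Y"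
proof -
  have cpt: "compact_space X" and "metrizable_space X"
    using assms by (auto simp: metrizable_compactum_def)
  then obtain M d where Md: "Metric_space M d" and X: "X = Metric_space.mtopology M d"
    by (auto simp: metrizable_space_def)
  interpret Metric_space M d by (rule Md)
  have top: "topspace X = M" by (simp add: X)
  have "mtotally_bounded M"
    using cpt compactin_imp_mtotally_bounded unfolding X compact_space_def by simp
  then have "\<exists>K. finite K \<and> K \<subseteq> M \<and> M \<subseteq> (\<Union>x\<in>K. mball x (1 / real (Suc n)))" for n
    unfolding mtotally_bounded_def by (metis of_nat_0_less_iff zero_less_Suc zero_less_divide_1_iff)
  then obtain K where K: "\<And>n. finite (K n)" "\<And>n. K n \<subseteq> M"
      "\<And>n. M \<subseteq> (\<Union>x\<in>K n. mball x (1 / real (Suc n)))"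
    by metis
  define S where "S = (\<Union>n. K n)"
  have "countable S"
    unfolding S_def using K(1) by (auto intro: countable_finite)
  define g where "g = (\<lambda>x n. d x (from_nat_into S n))"
  have inj: "inj_on g M"
  proof (rule inj_onI, rule ccontr)
    fix x y assume x: "x \<in> M" and y: "y \<in> M" and eq: "g x = g y" and ne: "x \<noteq> y"
    then have "d x y > 0" by simp
    then obtain n where n: "1 / real (Suc n) < d x y / 2"
      by (metis half_gt_zero nat_approx_posE)
    obtain s where s: "s \<in> K n" "d s x < 1 / real (Suc n)" "s \<in> M"
      using K(3)[of n] x by auto
    then have "s \<in> S" by (auto simp: S_def)
    then obtain m where "from_nat_into S m = s"
      using from_nat_into_surj[OF \<open>countable S\<close>] by blast
    then have "d x s = d y s" using fun_cong[OF eq, of m] by (simp add: g_def)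
    moreover have "d x y \<le> d x s + d s y" using triangle x y s by blast
    ultimately show False using s n commute[of x s] commute[of y s] by linarith
  qed
  define h where "h = inv_into M g"
  define Y where "Y = pullback_topology (g ` M) h X"
  have hg: "h (g x) = x" if "x \<in> M" for x using that inj by (simp add: h_def)
  have topY: "topspace Y = g ` M"
    using hg by (auto simp: Y_def topspace_pullback_topology top)
  have "homeomorphic_maps X Y g h"
    unfolding homeomorphic_maps_def
  proof (intro conjI)
    show "continuous_map Y X h"
      unfolding Y_def by (rule continuous_map_pullback[where g = id, simplified]) simp
    show "continuous_map X Y g"
      unfolding Y_def
    proof (rule continuous_map_pullback')
      show "continuous_map X X (h \<circ> g)"
        by (rule continuous_map_eq[OF continuous_map_id]) (auto simp: top hg)
      show "topspace X \<subseteq> g -` (g ` M)" by (auto simp: top)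
    qed
  qed (auto simp: top topY hg)
  then show ?thesis unfolding homeomorphic_space_def by blast
qed

lemma compactifiableI:
  fixes A :: "'a topology" and B :: "'b topology" and C :: "'c topology set"
  assumes A: "metrizable_compactum A" and B: "metrizable_compactum B"
    and q: "continuous_map A B q" and C: "equivalent_classes (fibers A B q) C"
  shows "compactifiable C"
proof -
  obtain A' :: "(nat \<Rightarrow> real) topology" and g g' where g: "homeomorphic_maps A A' g g'"
    using metrizable_compactum_copy[OF A] unfolding homeomorphic_space_def by blast
  obtain B' :: "(nat \<Rightarrow> real) topology" and h h' where h: "homeomorphic_maps B B' h h'"
    using metrizable_compactum_copy[OF B] unfolding homeomorphic_space_def by blast
  have AA': "A homeomorphic_space A'" and BB': "B homeomorphic_space B'"
    using g h by (auto simp: homeomorphic_space_def)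
  have mA: "metrizable_compactum A'"
    using A homeomorphic_compact_space[OF AA'] homeomorphic_metrizable_space[OF AA']
    by (simp add: metrizable_compactum_def)
  have mB: "metrizable_compactum B'"
    using B homeomorphic_compact_space[OF BB'] homeomorphic_metrizable_space[OF BB']
    by (simp add: metrizable_compactum_def)
  define q' where "q' = h \<circ> q \<circ> g'"
  have q': "continuous_map A' B' q'"
    using g h q unfolding q'_def homeomorphic_maps_def
    by (meson continuous_map_compose)
  have gA: "g x \<in> topspace A'" "g' (g x) = x" if "x \<in> topspace A" for x
    using g that by (auto simp: homeomorphic_maps_def continuous_map_def)
  have gA': "g' x \<in> topspace A" "g (g' x) = x" if "x \<in> topspace A'" for x
    using g that by (auto simp: homeomorphic_maps_def continuous_map_def)
  have hB: "h x \<in> topspace B'" "h' (h x) = x" if "x \<in> topspace B" for x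
    using h that by (auto simp: homeomorphic_maps_def continuous_map_def)
  have hB': "h' x \<in> topspace B" "h (h' x) = x" if "x \<in> topspace B'" for x
    using h that by (auto simp: homeomorphic_maps_def continuous_map_def)
  have qB: "q x \<in> topspace B" if "x \<in> topspace A" for x
    using q that by (auto simp: continuous_map_def)
  have fib: "subtopology A {a \<in> topspace A. q a = b} homeomorphic_space
             subtopology A' {a \<in> topspace A'. q' a = h b}" if b: "b \<in> topspace B" for b
  proof -
    have "g ` (topspace A \<inter> {a \<in> topspace A. q a = b})
        = topspace A' \<inter> {a \<in> topspace A'. q' a = h b}"
    proof (intro equalityI subsetI)
      fix y assume "y \<in> topspace A' \<inter> {a \<in> topspace A'. q' a = h b}"
      then have y: "y \<in> topspace A'" "h (q (g' y)) = h b" by (auto simp: q'_def)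
      then have "q (g' y) = b" using hB(2) b qB gA' by metis
      then show "y \<in> g ` (topspace A \<inter> {a \<in> topspace A. q a = b})"
        using gA' y by (auto intro!: image_eqI[of _ _ "g' y"])
    qed (auto simp: q'_def gA)
    then have "homeomorphic_map (subtopology A {a \<in> topspace A. q a = b})
        (subtopology A' {a \<in> topspace A'. q' a = h b}) g"
      using g by (intro homeomorphic_map_subtopologies)
                 (auto simp: homeomorphic_map_maps)
    then show ?thesis by (auto simp: homeomorphic_space)
  qed
  have fib': "subtopology A' {a \<in> topspace A'. q' a = b} homeomorphic_space
             subtopology A {a \<in> topspace A. q a = h' b}" if b: "b \<in> topspace B'" for b
    using fib[OF hB'(1)[OF b]] unfolding hB'(2)[OF b] by (subst homeomorphic_space_sym)
  have "equivalent_classes (fibers A' B' q') C"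
    unfolding equivalent_classes_def
  proof (intro conjI ballI)
    fix X assume "X \<in> fibers A' B' q'"
    then obtain b where b: "b \<in> topspace B'" "X = subtopology A' {a \<in> topspace A'. q' a = b}"
      by (auto simp: fibers_def)
    have "subtopology A {a \<in> topspace A. q a = h' b} \<in> fibers A B q"
      using hB'(1)[OF b(1)] by (auto simp: fibers_def)
    then obtain Y where Y: "Y \<in> C"
        "subtopology A {a \<in> topspace A. q a = h' b} homeomorphic_space Y"
      using C unfolding equivalent_classes_def by blast
    have "X homeomorphic_space Y"
      unfolding b(2) by (rule homeomorphic_space_trans[OF fib'[OF b(1)] Y(2)])
    then show "\<exists>Y\<in>C. X homeomorphic_space Y"
      using Y(1) by blast
  next
    fix Y assume "Y \<in> C"
    then obtain Z where "Z \<in> fibers A B q" and YZ: "Y homeomorphic_space Z"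
      using C unfolding equivalent_classes_def by blast
    then obtain b where b: "b \<in> topspace B" "Z = subtopology A {a \<in> topspace A. q a = b}"
      by (auto simp: fibers_def)
    have "subtopology A' {a \<in> topspace A'. q' a = h b} \<in> fibers A' B' q'"
      using hB(1)[OF b(1)] by (auto simp: fibers_def)
    moreover have "Y homeomorphic_space subtopology A' {a \<in> topspace A'. q' a = h b}"
      by (rule homeomorphic_space_trans[OF YZ[unfolded b(2)] fib[OF b(1)]])
    ultimately show "\<exists>X\<in>fibers A' B' q'. Y homeomorphic_space X"
      by blast
  qed
  then show ?thesis
    unfolding compactifiable_def
    by (intro exI[of _ A'] exI[of _ B'] exI[of _ q'] conjI mA mB q')
qed

end

theory Submission
  imports Defs
begin

text \<open>
  A space that is an inverse limit over \<open>P\<close> is described by a sequence of members of \<open>P\<close> and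
  of surjections between them. For an arbitrary family of such sequences, the limits are the fibers
  of a projection: the total space consists of the pairs of a sequence and a point of its limit.
  This projection is a map between metrizable compacta as soon as the parameters of the sequences
  form a compact space and the total space is closed in a compact space. Two ideas make this work.

  The first is to use countably many surjections only. The set of continuous surjections between
  two metrizable compacta has a countable dense subset (\<open>countable_uniformly_dense_subset\<close>), and by
  Brown's theorem an inverse limit does not change up to homeomorphism if each bonding map is
  replaced by a sufficiently close one, where the required closeness depends on the maps chosen
  before (\<open>inverse_limit_approximation\<close>). So it suffices to consider paths in a countable graph,
  whose vertices are the members of \<open>P\<close> and whose arrows are the surjections of the dense sets.

  The second is to let a path rest. The space of all infinite paths in a countable graph is not
  compact, because infinitely many arrows may end at one vertex. If the arrows are enumerated
  and at time \<open>n\<close> only those with an index up to \<open>n\<close> may be used, then the parameters form the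
  compact product of the sets \<open>{..n}\<close>. A path rests by an identity map until the arrow that it
  needs becomes available. Identity maps can be removed from an inverse sequence without
  changing its limit (\<open>ilim_cofinal\<close>), so that all limits still occur (\<open>path_realizable\<close>). In the
  other direction, identity maps are surjective, and a path that rests forever yields a
  member of \<open>P\<close>, hence again a limit over \<open>P\<close>. No unwanted fibers arise.

  The choice of the first member of \<open>P\<close> is an infinite choice as well. It is treated in the same
  way: all paths begin at an auxiliary vertex, which carries a member of \<open>P\<close>, nonempty if
  possible, and which can be left by a constant map from any member of \<open>P\<close>. Constant maps are
  not surjective in general, but this one is used only once and the limit depends on the rest of
  the sequence only. The projection of the total space is treated in \<open>compactifiable_path_limits\<close>,
  for any countable diagram of compact metric spaces.
\<close>

section \<open>Inverse limits of subspaces\<close>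

text \<open>
  The points of an inverse limit, for sets instead of topologies. The defining equation is
  directed from level \<open>Suc n\<close> to level \<open>n\<close>, so that it terminates as a rewrite rule.
\<close>

definition ilim :: "(nat \<Rightarrow> 'p set) \<Rightarrow> (nat \<Rightarrow> 'p \<Rightarrow> 'p) \<Rightarrow> (nat \<Rightarrow> 'p) set" where
  "ilim K f = {x. \<forall>n. x n \<in> K n \<and> f n (x (Suc n)) = x n}"

lemma ilim_mem: "x \<in> ilim K f \<Longrightarrow> x n \<in> K n"
  unfolding ilim_def by blast

lemma ilim_eq: "x \<in> ilim K f \<Longrightarrow> f n (x (Suc n)) = x n"
  unfolding ilim_def by simp

lemma ilimI: "(\<And>n. x n \<in> K n) \<Longrightarrow> (\<And>n. f n (x (Suc n)) = x n) \<Longrightarrow> x \<in> ilim K f"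
  unfolding ilim_def by simp

text \<open>
  For subspaces of one topological space, the inverse limit is a subspace of the function space.
  All later arguments about limits can therefore use the topology of the type
  \<open>nat \<Rightarrow> 'p\<close> and its convergent sequences.
\<close>

lemma inverse_limit_top_of_set:
  fixes K :: "nat \<Rightarrow> 'p::topological_space set"
  shows "inverse_limit (\<lambda>n. top_of_set (K n)) f = top_of_set (ilim K f)"
proof -
  have "product_topology (\<lambda>n. top_of_set (K n)) UNIV = top_of_set (Pi\<^sub>E UNIV K)"
    by (simp add: subtopology_product_topology[symmetric] euclidean_product_topology)
  moreover have "x \<in> Pi\<^sub>E UNIV K \<inter> {x. \<forall>n. x n = f n (x (Suc n))} \<longleftrightarrow> x \<in> ilim K f" for x
    unfolding ilim_def PiE_UNIV_domain Pi_def by (simp add: eq_commute all_conj_distrib)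
  then have "Pi\<^sub>E UNIV K \<inter> {x. \<forall>n. x n = f n (x (Suc n))} = ilim K f"
    by blast
  ultimately show ?thesis
    unfolding inverse_limit_def by (simp only: subtopology_subtopology)
qed

lemma topspace_inverse_limit:
  "topspace (inverse_limit X f) = ilim (\<lambda>n. topspace (X n)) f"
proof -
  have "x \<in> topspace (inverse_limit X f) \<longleftrightarrow> x \<in> ilim (\<lambda>n. topspace (X n)) f" for x
    unfolding inverse_limit_def ilim_def topspace_subtopology topspace_product_topology
      PiE_UNIV_domain Pi_def by (simp add: eq_commute all_conj_distrib)
  then show ?thesis by blast
qed

lemma continuous_map_inverse_limit_levelwise:
  assumes h: "\<And>n. continuous_map (X n) (Y n) (h n)"
    and comm: "\<And>n x. x \<in> topspace (X (Suc n)) \<Longrightarrow> h n (f n x) = g n (h (Suc n) x)"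
  shows "continuous_map (inverse_limit X f) (inverse_limit Y g) (\<lambda>x n. h n (x n))"
proof -
  have "continuous_map (inverse_limit X f) (Y n) (\<lambda>x. h n (x n))" for n
  proof -
    have "continuous_map (inverse_limit X f) (X n) (\<lambda>x. x n)"
      unfolding inverse_limit_def
      by (intro continuous_map_from_subtopology continuous_map_product_projection) simp
    from continuous_map_compose[OF this h] show ?thesis by (simp add: o_def)
  qed
  then have "continuous_map (inverse_limit X f) (product_topology Y UNIV) (\<lambda>x n. h n (x n))"
    by (simp add: continuous_map_componentwise_UNIV)
  moreover have "h n (x n) = g n (h (Suc n) (x (Suc n)))"
    if "x \<in> topspace (inverse_limit X f)" for x n
  proof -
    have "x (Suc n) \<in> topspace (X (Suc n))" "x n = f n (x (Suc n))"
      using ilim_mem[of x _ f "Suc n"] ilim_eq[of x _ f n] that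
      unfolding topspace_inverse_limit by auto
    then show ?thesis using comm[of "x (Suc n)" n] by simp
  qed
  ultimately show ?thesis
    unfolding inverse_limit_def[of Y] continuous_map_in_subtopology by blast
qed

text \<open>
  Inverse limits are functorial. It suffices to check that the \<open>h n\<close> commute with the bonding
  maps: applying \<open>k n\<close> to both sides gives the same for the inverses.
\<close>

lemma inverse_limit_homeomorphic_levelwise:
  assumes hk: "\<And>n. homeomorphic_maps (X n) (Y n) (h n) (k n)"
    and f: "\<And>n. f n ` topspace (X (Suc n)) \<subseteq> topspace (X n)"
    and comm: "\<And>n x. x \<in> topspace (X (Suc n)) \<Longrightarrow> h n (f n x) = g n (h (Suc n) x)"
  shows "inverse_limit X f homeomorphic_space inverse_limit Y g"
proof -
  have h: "continuous_map (X n) (Y n) (h n)" and k: "continuous_map (Y n) (X n) (k n)"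
    and kh: "x \<in> topspace (X n) \<Longrightarrow> k n (h n x) = x"
    and hk': "y \<in> topspace (Y n) \<Longrightarrow> h n (k n y) = y" for n x y
    using hk[of n] by (auto simp: homeomorphic_maps_def)
  have kY: "k n y \<in> topspace (X n)" if "y \<in> topspace (Y n)" for n y
    using k[of n] that by (auto simp: continuous_map_def)
  have comm': "k n (g n y) = f n (k (Suc n) y)" if y: "y \<in> topspace (Y (Suc n))" for n y
  proof -
    have "h n (f n (k (Suc n) y)) = g n y"
      using comm[OF kY[OF y]] hk'[OF y] by simp
    then show ?thesis
      using kh[of "f n (k (Suc n) y)" n] f[of n] kY[OF y] by auto
  qed
  have "homeomorphic_maps (inverse_limit X f) (inverse_limit Y g)
          (\<lambda>x n. h n (x n)) (\<lambda>y n. k n (y n))"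
    unfolding homeomorphic_maps_def
  proof (intro conjI ballI ext)
    show "(\<lambda>n. k n (h n (x n))) n = x n" if "x \<in> topspace (inverse_limit X f)" for x n
      using kh ilim_mem that unfolding topspace_inverse_limit by metis
    show "(\<lambda>n. h n (k n (y n))) n = y n" if "y \<in> topspace (inverse_limit Y g)" for y n
      using hk' ilim_mem that unfolding topspace_inverse_limit by metis
    show "continuous_map (inverse_limit X f) (inverse_limit Y g) (\<lambda>x n. h n (x n))"
      by (rule continuous_map_inverse_limit_levelwise[where X=X and Y=Y and h=h and f=f and g=g])
        (rule h, rule comm)
    show "continuous_map (inverse_limit Y g) (inverse_limit X f) (\<lambda>y n. k n (y n))"
      by (rule continuous_map_inverse_limit_levelwise[where X=Y and Y=X and h=k and f=g and g=f])
        (rule k, rule comm')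
  qed
  then show ?thesis by (auto simp: homeomorphic_space_def)
qed

text \<open>
  The bonding map over \<open>k\<close> steps, from level \<open>m + k\<close> to level \<open>m\<close>.
\<close>

primrec composite :: "(nat \<Rightarrow> 'p \<Rightarrow> 'p) \<Rightarrow> nat \<Rightarrow> nat \<Rightarrow> 'p \<Rightarrow> 'p" where
  "composite f m 0 = id"
| "composite f m (Suc k) = composite f m k \<circ> f (m + k)"

lemma composite_Suc_left: "composite f m (Suc k) = f m \<circ> composite f (Suc m) k"
  by (induction k) (auto simp: fun_eq_iff)

lemma ilim_composite: "x \<in> ilim K f \<Longrightarrow> composite f m k (x (m + k)) = x m"
  by (induction k) (auto simp: ilim_eq)

lemma composite_add: "composite f m (j + k) = composite f m j \<circ> composite f (m + j) k"
  by (induction k) (simp_all add: comp_assoc add.assoc)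

lemma composite_into:
  assumes "\<And>n. f n ` K (Suc n) \<subseteq> K n" and "x \<in> K (n + k)"
  shows "composite f n k x \<in> K n"
  using assms(2)
proof (induction k arbitrary: x)
  case (Suc k)
  then show ?case using assms(1)[of "n + k"] by auto
qed simp

lemma continuous_on_composite:
  assumes "\<And>n. continuous_on (K (Suc n)) (f n)" and "\<And>n. f n ` K (Suc n) \<subseteq> K n"
  shows "continuous_on (K (n + k)) (composite f n k)"
proof (induction k)
  case (Suc k)
  then show ?case
    using continuous_on_compose[OF assms(1) continuous_on_subset[OF Suc assms(2)]] by simp
qed (simp add: id_def)

lemma homeomorphic_imp_homeomorphic_space:
  assumes "S homeomorphic T"
  shows "top_of_set S homeomorphic_space top_of_set T"
proof -
  obtain f g where "homeomorphism S T f g"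
    using assms unfolding homeomorphic_def by blast
  then have "homeomorphic_maps (top_of_set S) (top_of_set T) f g"
    unfolding homeomorphic_maps_def homeomorphism_def by auto
  then show ?thesis unfolding homeomorphic_space_def by blast
qed

text \<open>
  An inverse limit is determined by the levels of a subsequence: the other coordinates are images
  of later ones. This serves to drop an initial segment of an inverse sequence, and to remove
  identity maps from it.
\<close>

lemma ilim_cofinal:
  fixes K :: "nat \<Rightarrow> 'p::metric_space set"
  assumes cont: "\<And>n. continuous_on (K (Suc n)) (f n)" and into: "\<And>n. f n ` K (Suc n) \<subseteq> K n"
    and t: "strict_mono t"
  shows "ilim K f homeomorphic ilim (\<lambda>j. K (t j)) (\<lambda>j. composite f (t j) (t (Suc j) - t j))"
    (is "?L homeomorphic ?L'")
proof -
  have t_le: "m \<le> t m" for m using t by (rule strict_mono_imp_increasing)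
  have t_mono: "i \<le> j \<Longrightarrow> t i \<le> t j" for i j using t by (simp add: strict_mono_less_eq)
  have split: "composite f m (k - m) z = composite f m (j - m) (composite f j (k - j) z)"
    if "m \<le> j" "j \<le> k" for m j k z
    using composite_add[of f m "j - m" "k - j"] that by simp
  define up where "up = (\<lambda>(x :: nat \<Rightarrow> 'p) j. x (t j))"
  define down where "down = (\<lambda>(y :: nat \<Rightarrow> 'p) m. composite f m (t m - m) (y m))"
  have descend: "composite f (t j) (t i - t j) (y i) = y j" if y: "y \<in> ?L'" and "j \<le> i" for y j i
    using \<open>j \<le> i\<close>
  proof (induction i rule: dec_induct)
    case (step i)
    then show ?case
      using split[of "t j" "t i" "t (Suc i)" "y (Suc i)"] ilim_eq[OF y, of i] t_mono[of j i]
        t_mono[of i "Suc i"] by simp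
  qed simp
  have "homeomorphism ?L ?L' up down"
  proof (rule homeomorphismI)
    show "continuous_on ?L up"
      unfolding up_def
      by (intro continuous_on_coordinatewise_then_product
          continuous_on_subset[OF continuous_on_product_coordinates]) simp
    show "continuous_on ?L' down"
      unfolding down_def
    proof (rule continuous_on_coordinatewise_then_product)
      fix m
      have "continuous_on (K (t m)) (composite f m (t m - m))"
        using continuous_on_composite[of K f m "t m - m", OF cont into] t_le[of m] by simp
      moreover have "continuous_on ?L' (\<lambda>y. y m)"
        by (rule continuous_on_subset[OF continuous_on_product_coordinates]) simp
      ultimately show "continuous_on ?L' (\<lambda>y. composite f m (t m - m) (y m))"
        by (rule continuous_on_compose2) (auto dest: ilim_mem)
    qed
    show "up ` ?L \<subseteq> ?L'"
    proof (intro image_subsetI ilimI)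
      fix x j assume x: "x \<in> ?L"
      show "up x j \<in> K (t j)" using ilim_mem[OF x] by (simp add: up_def)
      show "composite f (t j) (t (Suc j) - t j) (up x (Suc j)) = up x j"
        using ilim_composite[OF x, of "t j" "t (Suc j) - t j"] t_mono[of j "Suc j"]
        by (simp add: up_def)
    qed
    show "down ` ?L' \<subseteq> ?L"
    proof (intro image_subsetI ilimI)
      fix y m assume y: "y \<in> ?L'"
      show "down y m \<in> K m"
        using composite_into[of f K, OF into, of "y m" m "t m - m"] ilim_mem[OF y, of m] t_le[of m]
        by (simp add: down_def)
      have le: "m \<le> t m" "t m \<le> t (Suc m)" "Suc m \<le> t (Suc m)"
        using t_le t_mono by auto
      have "f m (down y (Suc m)) = composite f m (Suc (t (Suc m) - Suc m)) (y (Suc m))"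
        unfolding composite_Suc_left down_def by simp
      also have "\<dots> = composite f m (t (Suc m) - m) (y (Suc m))"
        using le(3) by (simp only: Suc_diff_Suc Suc_le_eq)
      also have "\<dots> = down y m"
        using split[OF le(1,2)] ilim_eq[OF y, of m] by (simp add: down_def)
      finally show "f m (down y (Suc m)) = down y m" .
    qed
    show "down (up x) = x" if "x \<in> ?L" for x
    proof
      fix m show "down (up x) m = x m"
        using ilim_composite[OF that, of m "t m - m"] t_le[of m] by (simp add: up_def down_def)
    qed
    show "up (down y) = y" if "y \<in> ?L'" for y
    proof
      fix j show "up (down y) j = y j"
        using descend[OF that t_le[of j]] by (simp add: up_def down_def)
    qed
  qed
  then show ?thesis unfolding homeomorphic_def by blast
qed

section \<open>Approximation of inverse sequences\<close>

text \<open>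
  Both parts come from the telescoping bound
  \<open>dist (u j) (u (j + k)) \<le> 2 * c * ((1/2) ^ j - (1/2) ^ (j + k))\<close>.
\<close>

lemma geometric_steps:
  fixes u :: "nat \<Rightarrow> 'p::metric_space"
  assumes u: "\<And>k. dist (u k) (u (Suc k)) \<le> c * (1/2) ^ k"
  shows "dist (u j) (u (j + k)) \<le> 2 * c * (1/2) ^ j" and "Cauchy u"
proof -
  have c: "0 \<le> c" using order_trans[OF zero_le_dist u[of 0]] by simp
  have *: "dist (u j) (u (j + k)) \<le> 2 * c * (1/2) ^ j - 2 * c * (1/2) ^ (j + k)" for j k
  proof (induction k)
    case (Suc k)
    have "dist (u j) (u (j + Suc k)) \<le> dist (u j) (u (j + k)) + dist (u (j + k)) (u (Suc (j + k)))"
      by (simp add: dist_triangle)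
    then show ?case using Suc u[of "j + k"] by simp
  qed simp
  have **: "dist (u j) (u (j + k)) \<le> 2 * c * (1/2) ^ j" for j k
    by (rule order_trans[OF *]) (simp add: c)
  then show "dist (u j) (u (j + k)) \<le> 2 * c * (1/2) ^ j" .
  show "Cauchy u"
  proof (rule metric_CauchyI)
    fix e :: real assume e: "e > 0"
    have "(\<lambda>j. 2 * c * (1/2) ^ j) \<longlonglongrightarrow> 2 * c * 0"
      by (intro tendsto_intros) auto
    then have "eventually (\<lambda>j. 2 * c * (1/2) ^ j < e / 2) sequentially"
      by (rule order_tendstoD) (use e in auto)
    then obtain J where J: "2 * c * (1/2) ^ J < e / 2"
      by (auto simp: eventually_sequentially)
    have near: "dist (u J) (u i) < e / 2" if "i \<ge> J" for i
      using **[of J "i - J"] that J by simp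
    show "\<exists>M. \<forall>m\<ge>M. \<forall>n\<ge>M. dist (u m) (u n) < e"
      using near by (metis dist_commute dist_triangle_half_r)
  qed
qed

text \<open>
  Two sequences of bonding maps between the same spaces whose limits are to be compared. The set
  \<open>S n\<close> contains maps out of \<open>K n\<close>, among them every composite in which each step down from level
  \<open>n\<close> uses either of the two sequences. After any of them, the choice between \<open>f n\<close> and \<open>g n\<close> as a
  first step makes a difference of at most \<open>(1/2) ^ n\<close>. The conditions are symmetric in \<open>f\<close> and
  \<open>g\<close>, so that a construction for one direction serves for both.
\<close>

locale close_sequences =
  fixes K :: "nat \<Rightarrow> 'p::metric_space set" and f g :: "nat \<Rightarrow> 'p \<Rightarrow> 'p"
    and S :: "nat \<Rightarrow> ('p \<Rightarrow> 'p) set"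
  assumes K: "compact (K n)"
    and f_into: "f n ` K (Suc n) \<subseteq> K n" and g_into: "g n ` K (Suc n) \<subseteq> K n"
    and S_id: "id \<in> S n"
    and S_f: "\<phi> \<in> S n \<Longrightarrow> \<phi> \<circ> f n \<in> S (Suc n)" and S_g: "\<phi> \<in> S n \<Longrightarrow> \<phi> \<circ> g n \<in> S (Suc n)"
    and S_cont: "\<phi> \<in> S n \<Longrightarrow> continuous_on (K n) \<phi>"
    and close: "\<phi> \<in> S n \<Longrightarrow> x \<in> K (Suc n) \<Longrightarrow> dist (\<phi> (f n x)) (\<phi> (g n x)) \<le> (1/2) ^ n"
begin

lemma swap: "close_sequences K g f S"
  using K f_into g_into S_id S_f S_g S_cont close by unfold_locales (auto simp: dist_commute)

lemma S_composite: "\<phi> \<in> S n \<Longrightarrow> \<phi> \<circ> composite g n k \<in> S (n + k)"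
proof (induction k)
  case (Suc k)
  then show ?case using S_g[of "\<phi> \<circ> composite g n k" "n + k"] by (simp add: comp_def)
qed simp

text \<open>
  The candidate for the homeomorphism from the limit along \<open>f\<close> to the limit along \<open>g\<close>: take a far
  coordinate of \<open>x\<close> and push it down by the bonding maps \<open>g\<close>.
\<close>

definition transfer :: "(nat \<Rightarrow> 'p) \<Rightarrow> nat \<Rightarrow> 'p" where
  "transfer x n = lim (\<lambda>k. composite g n k (x (n + k)))"

context
  fixes x assumes x: "x \<in> ilim K f"
begin

text \<open>
  Replacing \<open>k\<close> by \<open>Suc k\<close> exchanges \<open>f (n + k)\<close>, which yields the coordinate \<open>x (n + k)\<close>, for
  \<open>g (n + k)\<close>, before the map \<open>\<phi> \<circ> composite g n k\<close>, which belongs to \<open>S (n + k)\<close>.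
\<close>

lemma transfer_steps:
  assumes "\<phi> \<in> S n"
  shows "dist (\<phi> (composite g n k (x (n + k)))) (\<phi> (composite g n (Suc k) (x (n + Suc k))))
      \<le> (1/2) ^ n * (1/2) ^ k"
  using close[OF S_composite[OF assms, of k], of "x (Suc (n + k))"]
    ilim_mem[OF x, of "Suc (n + k)"] ilim_eq[OF x, of "n + k"]
  by (simp add: power_add)

lemma transfer_tendsto: "(\<lambda>k. composite g n k (x (n + k))) \<longlonglongrightarrow> transfer x n"
  and transfer_mem: "transfer x n \<in> K n"
proof -
  have "Cauchy (\<lambda>k. composite g n k (x (n + k)))"
    using geometric_steps(2)[OF transfer_steps[OF S_id[of n]]] by simp
  then obtain l where l: "l \<in> K n" "(\<lambda>k. composite g n k (x (n + k))) \<longlonglongrightarrow> l"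
    using compact_imp_complete[OF K[of n], unfolded complete_def, rule_format,
        of "\<lambda>k. composite g n k (x (n + k))"] composite_into[of g K, OF g_into ilim_mem[OF x]] by blast
  then show "(\<lambda>k. composite g n k (x (n + k))) \<longlonglongrightarrow> transfer x n" "transfer x n \<in> K n"
    using limI[OF l(2)] by (auto simp: transfer_def)
qed

lemma transfer_close:
  assumes \<phi>: "\<phi> \<in> S n"
  shows "dist (\<phi> (x n)) (\<phi> (transfer x n)) \<le> 2 * (1/2) ^ n"
proof (rule tendsto_upperbound)
  have "(\<lambda>k. \<phi> (composite g n k (x (n + k)))) \<longlonglongrightarrow> \<phi> (transfer x n)"
    using transfer_mem composite_into[of g K, OF g_into ilim_mem[OF x]]
    by (intro continuous_on_tendsto_compose[OF S_cont[OF \<phi>] transfer_tendsto]) auto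
  then show "(\<lambda>k. dist (\<phi> (x n)) (\<phi> (composite g n k (x (n + k)))))
      \<longlonglongrightarrow> dist (\<phi> (x n)) (\<phi> (transfer x n))"
    by (intro tendsto_intros)
  show "\<forall>\<^sub>F k in sequentially. dist (\<phi> (x n)) (\<phi> (composite g n k (x (n + k)))) \<le> 2 * (1/2) ^ n"
    using geometric_steps(1)[OF transfer_steps[OF \<phi>], of 0] by simp
qed simp

lemma transfer_ilim: "transfer x \<in> ilim K g"
proof (rule ilimI[OF transfer_mem])
  fix n
  have "continuous_on (K (Suc n)) (g n)"
    using S_cont[OF S_g[OF S_id]] by simp
  then have "(\<lambda>k. g n (composite g (Suc n) k (x (Suc n + k)))) \<longlonglongrightarrow> g n (transfer x (Suc n))"
    using transfer_mem composite_into[of g K, OF g_into ilim_mem[OF x], of "Suc n"]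
    by (intro continuous_on_tendsto_compose[OF _ transfer_tendsto]) auto
  moreover have "(\<lambda>k. g n (composite g (Suc n) k (x (Suc n + k)))) \<longlonglongrightarrow> transfer x n"
    using LIMSEQ_Suc[OF transfer_tendsto[of n]]
    by (simp only: composite_Suc_left o_apply add_Suc_right add_Suc)
  ultimately show "g n (transfer x (Suc n)) = transfer x n"
    by (rule LIMSEQ_unique)
qed

end

text \<open>
  Each coordinate of \<open>transfer\<close> is a uniform limit of continuous functions, because the error
  estimate of \<open>transfer_close\<close> at level \<open>n + k\<close> does not depend on \<open>x\<close>.
\<close>

lemma continuous_on_transfer: "continuous_on (ilim K f) transfer"
proof (rule continuous_on_coordinatewise_then_product)
  fix n
  have "(\<lambda>k. 2 * (1/2) ^ (n + k) :: real) \<longlonglongrightarrow> 2 * ((1/2) ^ n * 0)"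
    unfolding power_add by (intro tendsto_intros) auto
  then have small: "(\<lambda>k. 2 * (1/2) ^ (n + k) :: real) \<longlonglongrightarrow> 0" by simp
  have near: "dist (composite g n k (x (n + k))) (transfer x n) \<le> 2 * (1/2) ^ (n + k)"
    if "x \<in> ilim K f" for x k
    using transfer_close[OF that S_composite[OF S_id, of n k]]
      ilim_composite[OF transfer_ilim[OF that], of n k] by simp
  show "continuous_on (ilim K f) (\<lambda>x. transfer x n)"
  proof (rule uniform_limit_theorem)
    show "uniform_limit (ilim K f) (\<lambda>k x. composite g n k (x (n + k))) (\<lambda>x. transfer x n) sequentially"
    proof (rule uniform_limitI)
      fix e :: real assume "e > 0"
      then have "\<forall>\<^sub>F k in sequentially. 2 * (1/2) ^ (n + k) < e"
        using order_tendstoD(2)[OF small] by blast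
      then show "\<forall>\<^sub>F k in sequentially. \<forall>x\<in>ilim K f.
          dist (composite g n k (x (n + k))) (transfer x n) < e"
        by eventually_elim (intro ballI le_less_trans[OF near])
    qed
    show "\<forall>\<^sub>F k in sequentially. continuous_on (ilim K f) (\<lambda>x. composite g n k (x (n + k)))"
    proof (intro always_eventually allI)
      fix k
      have "continuous_on (K (n + k)) (composite g n k)"
        using S_cont[OF S_composite[OF S_id]] by simp
      moreover have "continuous_on (ilim K f) (\<lambda>x. x (n + k))"
        by (rule continuous_on_subset[OF continuous_on_product_coordinates]) simp
      ultimately show "continuous_on (ilim K f) (\<lambda>x. composite g n k (x (n + k)))"
        by (rule continuous_on_compose2) (auto intro: ilim_mem)
    qed
  qed simp
qed

text \<open>
  Let \<open>z\<close> be the image of \<open>x\<close> under both transfers. At level \<open>n + k\<close> the points \<open>x\<close>,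
  \<open>transfer x\<close> and \<open>z\<close> have almost the same image under the composite of \<open>f\<close> that leads down to
  level \<open>n\<close>. For \<open>x\<close> and \<open>z\<close>, these images are \<open>x n\<close> and \<open>z n\<close>.
\<close>

lemma transfer_inverse:
  assumes x: "x \<in> ilim K f"
  shows "close_sequences.transfer f (transfer x) = x"
proof
  interpret sw: close_sequences K g f S by (rule swap)
  fix n
  define z where "z = sw.transfer (transfer x)"
  have z: "z \<in> ilim K f"
    unfolding z_def by (rule sw.transfer_ilim[OF transfer_ilim[OF x]])
  have le: "dist (x n) (z n) \<le> 4 * (1/2) ^ n * (1/2) ^ k" for k
  proof -
    have \<phi>: "composite f n k \<in> S (n + k)"
      using sw.S_composite[OF S_id, of n k] by simp
    have "dist (x n) (composite f n k (transfer x (n + k))) \<le> 2 * (1/2) ^ (n + k)"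
      using transfer_close[OF x \<phi>] by (simp add: ilim_composite[OF x])
    moreover have "dist (composite f n k (transfer x (n + k))) (z n) \<le> 2 * (1/2) ^ (n + k)"
      using sw.transfer_close[OF transfer_ilim[OF x] \<phi>]
      by (simp add: ilim_composite[OF z] flip: z_def)
    ultimately have "dist (x n) (z n) \<le> 4 * (1/2) ^ (n + k)"
      using dist_triangle[of "x n" "z n" "composite f n k (transfer x (n + k))"] by linarith
    then show ?thesis by (simp add: power_add)
  qed
  have "(\<lambda>k. 4 * (1/2) ^ n * (1/2) ^ k :: real) \<longlonglongrightarrow> 4 * (1/2) ^ n * 0"
    by (intro tendsto_intros) auto
  then have "dist (x n) (z n) \<le> 4 * (1/2) ^ n * 0"
    by (rule LIMSEQ_le_const) (use le in blast)
  then show "sw.transfer (transfer x) n = x n"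
    by (simp add: z_def)
qed

lemma ilim_homeomorphic: "ilim K f homeomorphic ilim K g"
proof -
  interpret sw: close_sequences K g f S by (rule swap)
  have "homeomorphism (ilim K f) (ilim K g) transfer sw.transfer"
  proof (rule homeomorphismI)
    show "continuous_on (ilim K f) transfer" "continuous_on (ilim K g) sw.transfer"
      by (rule continuous_on_transfer, rule sw.continuous_on_transfer)
    show "sw.transfer (transfer x) = x" if "x \<in> ilim K f" for x
      using that by (rule transfer_inverse)
    show "transfer (sw.transfer y) = y" if "y \<in> ilim K g" for y
      using that by (rule sw.transfer_inverse)
    show "transfer ` ilim K f \<subseteq> ilim K g" "sw.transfer ` ilim K g \<subseteq> ilim K f"
      using transfer_ilim sw.transfer_ilim by auto
  qed
  then show ?thesis
    unfolding homeomorphic_def by blast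
qed

end

text \<open>
  All maps that arise from level \<open>n\<close> by going down finitely many levels, where every step uses
  either \<open>f\<close> or the map that \<open>c\<close> selects. The selection at a level may depend on the set of words
  that exist so far; this is how an approximating sequence is chosen step by step.
\<close>

primrec words :: "(nat \<Rightarrow> 'p \<Rightarrow> 'p) \<Rightarrow> (nat \<Rightarrow> ('p \<Rightarrow> 'p) set \<Rightarrow> 'p \<Rightarrow> 'p) \<Rightarrow> nat \<Rightarrow> ('p \<Rightarrow> 'p) set" where
  "words f c 0 = {id}"
| "words f c (Suc n) = insert id
    ((\<lambda>\<phi>. \<phi> \<circ> f n) ` words f c n \<union> (\<lambda>\<phi>. \<phi> \<circ> c n (words f c n)) ` words f c n)"

lemma finite_words: "finite (words f c n)"
  by (induction n) auto

lemma compact_uniformly_equicontinuous_finite: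
  fixes \<Phi> :: "('a::metric_space \<Rightarrow> 'b::metric_space) set"
  assumes "finite \<Phi>" and K: "compact K" and "\<And>\<phi>. \<phi> \<in> \<Phi> \<Longrightarrow> continuous_on K \<phi>" and e: "e > 0"
  shows "\<exists>\<delta>>0. \<forall>\<phi>\<in>\<Phi>. \<forall>x\<in>K. \<forall>y\<in>K. dist x y < \<delta> \<longrightarrow> dist (\<phi> x) (\<phi> y) < e"
  using assms(1,3)
proof (induction \<Phi> rule: finite_induct)
  case empty
  then show ?case by (auto intro: exI[of _ 1])
next
  case (insert \<psi> \<Phi>)
  then obtain \<delta>1 where d1: "\<delta>1 > 0"
      "\<forall>\<phi>\<in>\<Phi>. \<forall>x\<in>K. \<forall>y\<in>K. dist x y < \<delta>1 \<longrightarrow> dist (\<phi> x) (\<phi> y) < e" by auto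
  have "uniformly_continuous_on K \<psi>"
    using insert.prems K compact_uniformly_continuous by blast
  then obtain \<delta>2 where d2: "\<delta>2 > 0" "\<forall>x\<in>K. \<forall>y\<in>K. dist y x < \<delta>2 \<longrightarrow> dist (\<psi> y) (\<psi> x) < e"
    unfolding uniformly_continuous_on_def using e by metis
  show ?case
    using d1 d2 by (intro exI[of _ "min \<delta>1 \<delta>2"]) auto
qed

text \<open>
  Brown's approximation theorem. At level \<open>n\<close> there are finitely many words in the maps chosen so
  far, and they are uniformly continuous. Hence, if \<open>g n\<close> is sufficiently close to \<open>f n\<close>, it is
  indistinguishable from \<open>f n\<close> up to \<open>(1/2) ^ n\<close> after any of these words, which is what
  \<open>close_sequences\<close> demands.
\<close>

theorem inverse_limit_approximation:
  fixes K :: "nat \<Rightarrow> 'p::metric_space set"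
  assumes K: "\<And>n. compact (K n)"
    and f: "\<And>n. continuous_on (K (Suc n)) (f n)" "\<And>n. f n ` K (Suc n) \<subseteq> K n"
    and D: "\<And>n g. g \<in> D n \<Longrightarrow> continuous_on (K (Suc n)) g" "\<And>n g. g \<in> D n \<Longrightarrow> g ` K (Suc n) \<subseteq> K n"
    and dense: "\<And>n e. e > 0 \<Longrightarrow> \<exists>g\<in>D n. \<forall>x\<in>K (Suc n). dist (f n x) (g x) < e"
  shows "\<exists>g. (\<forall>n. g n \<in> D n) \<and> ilim K f homeomorphic ilim K g"
proof -
  define c where "c = (\<lambda>n (\<Phi> :: ('p \<Rightarrow> 'p) set). SOME g. g \<in> D n \<and>
    (\<forall>\<phi>\<in>\<Phi>. \<forall>x\<in>K (Suc n). dist (\<phi> (f n x)) (\<phi> (g x)) \<le> (1/2) ^ n))"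
  define S where "S = words f c"
  define g where "g = (\<lambda>n. c n (S n))"
  have g: "g n \<in> D n \<and> (\<forall>\<phi>\<in>S n. \<forall>x\<in>K (Suc n). dist (\<phi> (f n x)) (\<phi> (g n x)) \<le> (1/2) ^ n)"
    if cont: "\<And>\<phi>. \<phi> \<in> S n \<Longrightarrow> continuous_on (K n) \<phi>" for n
  proof -
    have "\<exists>\<delta>>0. \<forall>\<phi>\<in>S n. \<forall>x\<in>K n. \<forall>y\<in>K n. dist x y < \<delta> \<longrightarrow> dist (\<phi> x) (\<phi> y) < (1/2) ^ n"
      by (rule compact_uniformly_equicontinuous_finite) (auto simp: S_def finite_words K cont)
    then obtain \<delta> where \<delta>: "\<delta> > 0"
      "\<And>\<phi> x y. \<phi> \<in> S n \<Longrightarrow> x \<in> K n \<Longrightarrow> y \<in> K n \<Longrightarrow> dist x y < \<delta> \<Longrightarrow> dist (\<phi> x) (\<phi> y) < (1/2) ^ n"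
      by blast
    obtain h where h: "h \<in> D n" "\<And>x. x \<in> K (Suc n) \<Longrightarrow> dist (f n x) (h x) < \<delta>"
      using dense[OF \<delta>(1)] by blast
    have "\<exists>h. h \<in> D n \<and> (\<forall>\<phi>\<in>S n. \<forall>x\<in>K (Suc n). dist (\<phi> (f n x)) (\<phi> (h x)) \<le> (1/2) ^ n)"
    proof (intro exI[of _ h] conjI ballI h(1))
      fix \<phi> x assume \<phi>: "\<phi> \<in> S n" and x: "x \<in> K (Suc n)"
      have "f n x \<in> K n" "h x \<in> K n" using f(2)[of n] D(2)[OF h(1)] x by auto
      then show "dist (\<phi> (f n x)) (\<phi> (h x)) \<le> (1/2) ^ n"
        using \<delta>(2)[OF \<phi>] h(2)[OF x] less_imp_le by blast
    qed
    from someI_ex[OF this] show ?thesis unfolding g_def c_def .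
  qed
  have S_Suc: "S (Suc n) = insert id ((\<lambda>\<phi>. \<phi> \<circ> f n) ` S n \<union> (\<lambda>\<phi>. \<phi> \<circ> g n) ` S n)" for n
    by (simp add: S_def g_def)
  have cont: "\<phi> \<in> S n \<Longrightarrow> continuous_on (K n) \<phi>" for n \<phi>
  proof (induction n arbitrary: \<phi>)
    case (Suc n)
    have "g n \<in> D n" using g[of n, OF Suc.IH] by blast
    note gD = D(1)[OF this] D(2)[OF this]
    have "continuous_on (K (Suc n)) (\<psi> \<circ> f n)" "continuous_on (K (Suc n)) (\<psi> \<circ> g n)" if "\<psi> \<in> S n" for \<psi>
      by (rule continuous_on_compose[OF f(1) continuous_on_subset[OF Suc.IH[OF that] f(2)]],
          rule continuous_on_compose[OF gD(1) continuous_on_subset[OF Suc.IH[OF that] gD(2)]])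
    then show ?case using Suc.prems unfolding S_Suc by (auto intro: continuous_on_id simp: id_def)
  qed (auto simp: S_def id_def)
  have gD: "g n \<in> D n" for n using g[of n, OF cont] by blast
  interpret close_sequences K f g S
  proof
    show "id \<in> S n" for n by (cases n) (auto simp: S_def)
      show "dist (\<phi> (f n x)) (\<phi> (g n x)) \<le> (1/2) ^ n" if "\<phi> \<in> S n" "x \<in> K (Suc n)" for \<phi> n x
      using g[of n, OF cont] that by blast
  qed (use K f D[OF gD] cont S_Suc in auto)
  show ?thesis using gD ilim_homeomorphic by blast
qed

section \<open>Countable dense sets of maps\<close>

text \<open>
  Separability of sets of continuous functions between compact metric spaces, in the supremum
  distance. A function \<open>f\<close> is described with precision \<open>j\<close> by a function \<open>\<phi>\<close> from a finite net of
  \<open>K\<close> to a finite net of \<open>L\<close>, provided that \<open>f\<close> varies little around each point of the first net.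
  There are countably many descriptions, and two functions with a common one are close. So one
  function for each description that occurs in \<open>F\<close> is enough.
\<close>

lemma countable_uniformly_dense_subset:
  fixes F :: "('a::metric_space \<Rightarrow> 'b::metric_space) set"
  assumes K: "compact K" and L: "compact L"
    and cont: "\<And>f. f \<in> F \<Longrightarrow> continuous_on K f" and into: "\<And>f. f \<in> F \<Longrightarrow> f ` K \<subseteq> L"
  shows "\<exists>D\<subseteq>F. countable D \<and> (\<forall>f\<in>F. \<forall>e>0. \<exists>g\<in>D. \<forall>x\<in>K. dist (f x) (g x) < e)"
proof -
  have net: "\<exists>N. finite N \<and> N \<subseteq> C \<and> C \<subseteq> (\<Union>c\<in>N. ball c (1 / real (Suc n)))"
    if "compact C" for C :: "'c::metric_space set" and n
    using seq_compact_imp_totally_bounded[of C] that compact_imp_seq_compact by force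
  obtain N where N: "\<And>n. finite (N n)" "\<And>n. N n \<subseteq> K"
      "\<And>n. K \<subseteq> (\<Union>c\<in>N n. ball c (1 / real (Suc n)))"
    using net[OF K] by metis
  obtain M where M: "\<And>n. finite (M n)" "\<And>n. L \<subseteq> (\<Union>c\<in>M n. ball c (1 / real (Suc n)))"
    using net[OF L] by metis
  define coded where "coded = (\<lambda>(n, j, \<phi>) (f :: 'a \<Rightarrow> 'b). \<forall>c\<in>N n. \<forall>x\<in>K. dist c x < 1 / real (Suc n) \<longrightarrow>
      dist (\<phi> c) (f x) < 2 / real (Suc j))"
  define codes where "codes = (SIGMA n:UNIV. SIGMA j:UNIV. N n \<rightarrow>\<^sub>E M j)"
  define pick where "pick = (\<lambda>q. SOME f. f \<in> F \<and> coded q f)"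
  define D where "D = pick ` {q \<in> codes. \<exists>f\<in>F. coded q f}"
  have "countable codes"
    unfolding codes_def using N(1) M(1)
    by (intro countable_SIGMA countableI_type) (simp add: countable_finite finite_PiE)
  then have cD: "countable D"
    unfolding D_def by (intro countable_image countable_Collect) 
  have D: "pick q \<in> D" "pick q \<in> F" "coded q (pick q)"
    if q: "q \<in> codes" "f \<in> F" "coded q f" for q f
  proof -
    show "pick q \<in> D" using q unfolding D_def by blast
    have "\<exists>f. f \<in> F \<and> coded q f" using q by blast
    from someI_ex[OF this] show "pick q \<in> F" "coded q (pick q)" unfolding pick_def by auto
  qed
  have DF: "D \<subseteq> F"
    using D(2) unfolding D_def by blast
  have dense: "\<exists>g\<in>D. \<forall>x\<in>K. dist (f x) (g x) < e" if f: "f \<in> F" and e: "e > 0" for f e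
  proof -
    obtain j where j: "1 / real (Suc j) < e / 4"
      using e nat_approx_posE[of "e / 4"] by auto
    have "uniformly_continuous_on K f"
      using cont[OF f] K compact_uniformly_continuous by blast
    then obtain \<delta> where \<delta>: "\<delta> > 0" "\<And>x y. x \<in> K \<Longrightarrow> y \<in> K \<Longrightarrow> dist x y < \<delta> \<Longrightarrow> dist (f x) (f y) < 1 / real (Suc j)"
      using uniformly_continuous_onE[of K f "1 / real (Suc j)"] by (auto simp: dist_commute)
    obtain n where n: "1 / real (Suc n) < \<delta>"
      using nat_approx_posE[OF \<delta>(1)] by auto
    have "\<exists>m\<in>M j. dist m (f c) < 1 / real (Suc j)" if "c \<in> N n" for c
    proof -
      have "f c \<in> L" using into[OF f] N(2)[of n] that by blast
      then obtain m where "m \<in> M j" "f c \<in> ball m (1 / real (Suc j))"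
        using M(2)[of j] by blast
      then show ?thesis unfolding mem_ball by blast
    qed
    then obtain \<phi> where \<phi>: "\<And>c. c \<in> N n \<Longrightarrow> \<phi> c \<in> M j" "\<And>c. c \<in> N n \<Longrightarrow> dist (\<phi> c) (f c) < 1 / real (Suc j)"
      by metis
    define q where "q = (n, j, restrict \<phi> (N n))"
    have "q \<in> codes" using \<phi>(1) by (auto simp: q_def codes_def)
    moreover have "coded q f"
      unfolding coded_def q_def
    proof (clarsimp simp del: of_nat_Suc)
      fix c x assume cx: "c \<in> N n" "x \<in> K" "dist c x < 1 / real (Suc n)"
      then have "dist (f c) (f x) < 1 / real (Suc j)"
        using \<delta>(2)[of c x] N(2)[of n] n by force
      then show "dist (\<phi> c) (f x) < 2 / real (Suc j)"
        using \<phi>(2)[OF cx(1)] dist_triangle[of "\<phi> c" "f x" "f c"] by linarith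
    qed
    ultimately obtain g where g: "g \<in> D" "coded q g" using D[of q f] f by blast
    have "dist (f x) (g x) < e" if x: "x \<in> K" for x
    proof -
      obtain c where c: "c \<in> N n" "dist c x < 1 / real (Suc n)"
        using N(3)[of n] x by auto
      have "dist (\<phi> c) (f x) < 2 / real (Suc j)" "dist (\<phi> c) (g x) < 2 / real (Suc j)"
        using \<open>coded q f\<close> g(2) c x unfolding coded_def q_def by auto
      then show ?thesis
        using j dist_triangle3[of "f x" "g x" "\<phi> c"] by linarith
    qed
    then show ?thesis using g(1) by blast
  qed
  show ?thesis
    by (intro exI[of _ D] conjI DF cD ballI allI impI dense)
qed

section \<open>Paths in a countable diagram\<close>

text \<open>
  A countable diagram of compact spaces \<open>V v\<close>, with an enumeration of arrows; the vertex \<open>0\<close> is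
  the starting point of all paths.
\<close>

locale arrow_system =
  fixes V :: "nat \<Rightarrow> 'p::metric_space set"
    and codom domain :: "nat \<Rightarrow> nat" and arrow :: "nat \<Rightarrow> 'p \<Rightarrow> 'p"
  assumes V: "compact (V v)"
    and arrow_cont: "continuous_on (V (domain k)) (arrow k)"
    and arrow_into: "arrow k ` V (domain k) \<subseteq> V (codom k)"
begin

text \<open>
  A sequence \<open>b\<close> of arrow indices describes a path in the diagram. If the arrow \<open>b n\<close> ends at the
  current position, the path steps backwards along it; otherwise the path rests at time \<open>n\<close>. Thus
  every sequence describes a path, and its first terms determine the path up to a given time. The
  maps along the path are the bonding maps of an inverse sequence, the identity for a rest.
\<close>

primrec position :: "(nat \<Rightarrow> nat) \<Rightarrow> nat \<Rightarrow> nat" where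
  "position b 0 = 0"
| "position b (Suc n) = (if codom (b n) = position b n then domain (b n) else position b n)"

definition bond :: "(nat \<Rightarrow> nat) \<Rightarrow> nat \<Rightarrow> 'p \<Rightarrow> 'p" where
  "bond b n = (if codom (b n) = position b n then arrow (b n) else id)"

definition path_limit :: "(nat \<Rightarrow> nat) \<Rightarrow> (nat \<Rightarrow> 'p) set" where
  "path_limit b = ilim (\<lambda>n. V (position b n)) (bond b)"

text \<open>
  The bound \<open>b n \<le> n\<close> makes the space of sequences compact. No arrow is lost, as a path may rest
  until the index of the arrow that it needs is admissible.
\<close>

definition schedules :: "(nat \<Rightarrow> nat) set" where
  "schedules = {b. \<forall>n. b n \<le> n}"

definition total_space :: "((nat \<Rightarrow> nat) \<times> (nat \<Rightarrow> 'p)) set" where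
  "total_space = {(b, x). b \<in> schedules \<and> x \<in> path_limit b}"

lemma bond_cont: "continuous_on (V (position b (Suc n))) (bond b n)"
  using arrow_cont by (auto simp: bond_def id_def)

lemma bond_into: "bond b n ` V (position b (Suc n)) \<subseteq> V (position b n)"
  using arrow_into[of "b n"] by (auto simp: bond_def)

lemma position_cong: "(\<And>i. i < n \<Longrightarrow> b i = b' i) \<Longrightarrow> position b n = position b' n"
  by (induction n) auto

lemma bond_cong: "(\<And>i. i \<le> n \<Longrightarrow> b i = b' i) \<Longrightarrow> bond b n = bond b' n"
  using position_cong[of n b b'] by (simp add: bond_def)

lemma compact_schedules: "compact schedules"
proof -
  have "schedules = (\<Pi>\<^sub>E n\<in>UNIV. {..n})"
    by (auto simp: schedules_def PiE_UNIV_domain)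
  then show ?thesis
    using compactin_PiE[of "\<lambda>_. euclidean" UNIV "\<lambda>n::nat. {..n}"]
    by (simp add: euclidean_product_topology finite_imp_compact)
qed

lemma position_schedules:
  "b \<in> schedules \<Longrightarrow> position b n = 0 \<or> (\<exists>k<n. position b n = domain k)"
proof (induction n)
  case (Suc n)
  have "b n < Suc n" using Suc.prems by (simp add: schedules_def le_imp_less_Suc)
  then show ?case using Suc.IH[OF Suc.prems] by (auto simp: less_Suc_eq)
qed simp

text \<open>
  Membership is a condition on each \<open>n\<close> that depends on \<open>b\<close> only through finitely many terms.
  Along a convergent sequence these terms are eventually constant, and the condition becomes one
  about membership in a fixed compact set and an equation between continuous functions.
\<close>

lemma closed_total_space: "closed total_space"
  unfolding closed_sequential_limits
proof (intro allI impI, elim conjE)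
  fix z :: "nat \<Rightarrow> (nat \<Rightarrow> nat) \<times> (nat \<Rightarrow> 'p)" and l
  assume z: "\<forall>i. z i \<in> total_space" and lim: "z \<longlonglongrightarrow> l"
  obtain b x where l: "l = (b, x)" by (cases l)
  have coord: "(\<lambda>i. y i n) \<longlonglongrightarrow> y' n" if "y \<longlonglongrightarrow> y'" for y and y' :: "nat \<Rightarrow> 'c::topological_space" and n
    using continuous_on_tendsto_compose[OF continuous_on_product_coordinates that] by simp
  have b: "(\<lambda>i. fst (z i) n) \<longlonglongrightarrow> b n" and x: "(\<lambda>i. snd (z i) n) \<longlonglongrightarrow> x n" for n
    using coord[OF tendsto_fst[OF lim]] coord[OF tendsto_snd[OF lim]] by (simp_all add: l)
  have "\<forall>\<^sub>F i in sequentially. fst (z i) n = b n" for n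
    using b[of n] by (simp add: tendsto_discrete)
  then have ev: "\<forall>\<^sub>F i in sequentially. \<forall>j\<in>{..n}. fst (z i) j = b j" for n
    by (intro eventually_ball_finite) auto
  have mem: "fst (z i) \<in> schedules" "snd (z i) \<in> path_limit (fst (z i))" for i
    using z by (auto simp: total_space_def split_beta)
  have "b n \<le> n" for n
  proof -
    obtain i where "fst (z i) n = b n"
      using ev[of n] eventually_happens'[OF sequentially_bot] by fastforce
    moreover have "fst (z i) n \<le> n" using mem(1)[of i] by (simp add: schedules_def)
    ultimately show ?thesis by simp
  qed
  then have "b \<in> schedules" by (simp add: schedules_def)
  have pos: "\<forall>\<^sub>F i in sequentially. position (fst (z i)) n = position b n" for n
    using ev[of n] by eventually_elim (auto intro: position_cong)
  have bnd: "\<forall>\<^sub>F i in sequentially. bond (fst (z i)) n = bond b n" for n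
    using ev[of n] by eventually_elim (auto intro: bond_cong)
  have inV: "\<forall>\<^sub>F i in sequentially. snd (z i) n \<in> V (position b n)" for n
    using pos[of n] by eventually_elim (metis ilim_mem mem(2) path_limit_def)
  have xV: "x n \<in> V (position b n)" for n
    using Lim_in_closed_set[OF compact_imp_closed[OF V] inV _ x] by simp
  have "(\<lambda>i. bond b n (snd (z i) (Suc n))) \<longlonglongrightarrow> bond b n (x (Suc n))" for n
    by (rule continuous_on_tendsto_compose[OF bond_cont x xV inV])
  moreover have "\<forall>\<^sub>F i in sequentially. bond b n (snd (z i) (Suc n)) = snd (z i) n" for n
    using bnd[of n] by eventually_elim (metis ilim_eq mem(2) path_limit_def)
  ultimately have "(\<lambda>i. snd (z i) n) \<longlonglongrightarrow> bond b n (x (Suc n))" for n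
    by (rule Lim_transform_eventually)
  then have "bond b n (x (Suc n)) = x n" for n
    using LIMSEQ_unique x by blast
  then have "x \<in> path_limit b"
    unfolding path_limit_def by (intro ilimI xV)
  then show "l \<in> total_space"
    using \<open>b \<in> schedules\<close> by (simp add: total_space_def l)
qed

text \<open>
  At time \<open>n\<close> only the vertex \<open>0\<close> and the sources of the first \<open>n\<close> arrows can be reached, so that
  the coordinate \<open>x n\<close> ranges in a compact set \<open>C n\<close>.
\<close>

lemma compact_total_space: "compact total_space"
proof -
  define C where "C = (\<lambda>n. V 0 \<union> (\<Union>k<n. V (domain k)))"
  have "compact (C n)" for n
    unfolding C_def by (intro compact_Un compact_UN V) auto
  then have C: "compact (Pi\<^sub>E UNIV C)"
    using compactin_PiE[of "\<lambda>_. euclidean" UNIV C] by (simp add: euclidean_product_topology)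
  have "total_space \<subseteq> schedules \<times> Pi\<^sub>E UNIV C"
  proof (clarsimp simp: total_space_def PiE_UNIV_domain)
    fix b x n assume b: "b \<in> schedules" and x: "x \<in> path_limit b"
    show "x n \<in> C n"
      using ilim_mem[OF x[unfolded path_limit_def], of n] position_schedules[OF b, of n]
      by (auto simp: C_def)
  qed
  then have "total_space = (schedules \<times> Pi\<^sub>E UNIV C) \<inter> total_space" by blast
  also have "compact \<dots>"
    by (intro compact_Int_closed compact_Times compact_schedules C closed_total_space)
  finally show ?thesis .
qed

lemma metrizable_space_nat_sequences: "metrizable_space (euclidean :: (nat \<Rightarrow> nat) topology)"
proof -
  have "euclidean = (discrete_topology UNIV :: nat topology)"
    by (simp add: topology_eq open_discrete flip: open_openin)
  then have "metrizable_space (euclidean :: nat topology)" by simp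
  then have "metrizable_space (product_topology (\<lambda>_. euclidean) UNIV :: (nat \<Rightarrow> nat) topology)"
    by (intro metrizable_topology_D) auto
  then show ?thesis by (simp only: euclidean_product_topology)
qed

lemma metrizable_compactum_schedules: "metrizable_compactum (top_of_set schedules)"
  using compact_schedules metrizable_space_nat_sequences
  by (simp add: metrizable_compactum_def metrizable_space_subtopology compact_space_subtopology)

lemma metrizable_compactum_total_space: "metrizable_compactum (top_of_set total_space)"
proof -
  have "metrizable_space (prod_topology (euclidean :: (nat \<Rightarrow> nat) topology)
      (euclidean :: (nat \<Rightarrow> 'p) topology))"
    using metrizable_space_nat_sequences metrizable_space_euclidean
    unfolding metrizable_space_prod_topology by blast
  then show ?thesis
    using compact_total_space
    by (simp add: metrizable_compactum_def metrizable_space_subtopology compact_space_subtopology)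
qed

lemma fiber_homeomorphic_path_limit:
  assumes b: "b \<in> schedules"
  shows "subtopology (top_of_set total_space) {a \<in> topspace (top_of_set total_space). fst a = b}
    homeomorphic_space top_of_set (path_limit b)"
proof -
  have eq: "subtopology (top_of_set total_space) {a \<in> topspace (top_of_set total_space). fst a = b}
      = top_of_set ({b} \<times> path_limit b)"
  proof -
    have "total_space \<inter> {a \<in> topspace (top_of_set total_space). fst a = b} = {b} \<times> path_limit b"
      using b by (auto simp: total_space_def)
    then show ?thesis by (simp only: subtopology_subtopology)
  qed
  have "homeomorphism ({b} \<times> path_limit b) (path_limit b) snd (Pair b)"
    by (rule homeomorphismI) (auto intro: continuous_on_fst continuous_on_snd continuous_on_Pair continuous_on_id continuous_on_const)
  then show ?thesis
    unfolding eq by (intro homeomorphic_imp_homeomorphic_space) (auto simp: homeomorphic_def)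
qed

theorem compactifiable_path_limits:
  assumes sound: "\<And>b. b \<in> schedules \<Longrightarrow> \<exists>Y\<in>C. top_of_set (path_limit b) homeomorphic_space Y"
    and complete: "\<And>Y. Y \<in> C \<Longrightarrow> \<exists>b\<in>schedules. Y homeomorphic_space top_of_set (path_limit b)"
  shows "compactifiable C"
proof (rule compactifiableI)
  show "metrizable_compactum (top_of_set total_space)" by (rule metrizable_compactum_total_space)
  show "metrizable_compactum (top_of_set schedules)" by (rule metrizable_compactum_schedules)
  show "continuous_map (top_of_set total_space) (top_of_set schedules) fst"
    unfolding continuous_map_in_subtopology continuous_map_iff_continuous
  proof
    show "continuous_on total_space fst" by (rule continuous_on_fst[OF continuous_on_id])
    show "fst \<in> topspace (top_of_set total_space) \<rightarrow> schedules" by (auto simp: total_space_def)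
  qed
  show "equivalent_classes (fibers (top_of_set total_space) (top_of_set schedules) fst) C"
    unfolding equivalent_classes_def
  proof (intro conjI ballI)
    fix X assume "X \<in> fibers (top_of_set total_space) (top_of_set schedules) fst"
    then obtain b where b: "b \<in> schedules"
      "X = subtopology (top_of_set total_space) {a \<in> topspace (top_of_set total_space). fst a = b}"
      unfolding fibers_def by auto
    then show "\<exists>Y\<in>C. X homeomorphic_space Y"
      using sound[OF b(1)] fiber_homeomorphic_path_limit[OF b(1)] homeomorphic_space_trans by blast
  next
    fix Y assume "Y \<in> C"
    then obtain b where b: "b \<in> schedules" "Y homeomorphic_space top_of_set (path_limit b)"
      using complete by blast
    have "subtopology (top_of_set total_space) {a \<in> topspace (top_of_set total_space). fst a = b}
        \<in> fibers (top_of_set total_space) (top_of_set schedules) fst"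
      unfolding fibers_def using b(1) by simp
    moreover have "Y homeomorphic_space
        subtopology (top_of_set total_space) {a \<in> topspace (top_of_set total_space). fst a = b}"
      using b fiber_homeomorphic_path_limit[OF b(1)] homeomorphic_space_sym homeomorphic_space_trans
      by blast
    ultimately show "\<exists>X\<in>fibers (top_of_set total_space) (top_of_set schedules) fst. Y homeomorphic_space X"
      by blast
  qed
qed

text \<open>
  Let \<open>\<kappa> n\<close> be the arrows of a path that leaves the vertex \<open>0\<close> at once and never returns. A schedule
  follows it by using the arrow \<open>\<kappa> n\<close> at a time \<open>t n \<ge> \<kappa> n\<close> and the index \<open>0\<close> at all other times.
  Index \<open>0\<close> is a loop at the vertex \<open>0\<close> that acts as the identity, and it causes a rest at any
  other vertex. By \<open>ilim_cofinal\<close> with the times \<open>Suc (t n)\<close>, the rests do not change the limit.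
\<close>

lemma path_realizable:
  assumes wait: "codom 0 = 0" "domain 0 = 0" "arrow 0 = id"
    and start: "codom (\<kappa> 0) = 0" and chain: "\<And>n. codom (\<kappa> (Suc n)) = domain (\<kappa> n)"
    and proper: "\<And>n. domain (\<kappa> n) \<noteq> 0"
  shows "\<exists>b\<in>schedules. path_limit b homeomorphic ilim (\<lambda>n. V (domain (\<kappa> n))) (\<lambda>n. arrow (\<kappa> (Suc n)))"
proof -
  define t where "t = (\<lambda>n. n + (\<Sum>j\<le>n. \<kappa> j))"
  have t: "strict_mono t"
    by (rule strict_mono_Suc_iff[THEN iffD2]) (simp add: t_def)
  then have inj: "inj t" by (rule strict_mono_imp_inj_on)
  have \<kappa>t: "\<kappa> n \<le> t n" for n
    using member_le_sum[of n "{..n}" \<kappa>] by (simp add: t_def trans_le_add2)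
  define b where "b = (\<lambda>m. if m \<in> range t then \<kappa> (inv t m) else 0)"
  have b_t: "b (t n) = \<kappa> n" for n using inj by (simp add: b_def)
  have b_wait: "b m = 0" if "m \<notin> range t" for m using that by (simp add: b_def)
  have "b m \<le> m" for m
    by (cases "m \<in> range t") (auto simp: b_t b_wait \<kappa>t)
  then have b: "b \<in> schedules" by (simp add: schedules_def)
  have between: "m \<notin> range t" if "t n < m" "m < t (Suc n)" for m n
    using that t by (auto simp: strict_mono_less)
  have initial: "position b m = 0" if "m \<le> t 0" for m
    using that
  proof (induction m)
    case (Suc m)
    then have "m \<notin> range t" using t by (auto simp: Suc_le_eq strict_mono_less)
    then show ?case using Suc by (simp add: b_wait wait)
  qed simp
  have idle: "position b (Suc (t n) + k) = domain (\<kappa> n)" "composite (bond b) (Suc (t n)) k = id"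
    if "Suc (t n) + k \<le> t (Suc n)" and "position b (Suc (t n)) = domain (\<kappa> n)" for n k
  proof -
    have "position b (Suc (t n) + k) = domain (\<kappa> n) \<and> composite (bond b) (Suc (t n)) k = id"
      using that
    proof (induction k)
      case (Suc k)
      then have "Suc (t n) + k \<notin> range t" by (intro between[of n]) auto
      then show ?case using Suc proper[of n] by (simp add: b_wait wait bond_def)
    qed simp
    then show "position b (Suc (t n) + k) = domain (\<kappa> n)" "composite (bond b) (Suc (t n)) k = id" by auto
  qed
  define gap where "gap = (\<lambda>n. t (Suc n) - Suc (t n))"
  have gap: "Suc (t n) + gap n = t (Suc n)" for n
    using strict_monoD[OF t, of n "Suc n"] by (simp add: gap_def)
  have pos: "position b (Suc (t n)) = domain (\<kappa> n)" for n
  proof (induction n)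
    case 0
    then show ?case using initial[of "t 0"] by (simp add: b_t start)
  next
    case (Suc n)
    then have "position b (t (Suc n)) = domain (\<kappa> n)"
      using idle(1)[of n "gap n"] unfolding gap by blast
    then show ?case by (simp add: b_t chain)
  qed
  have pos': "position b (t (Suc n)) = domain (\<kappa> n)" for n
    using idle(1)[of n "gap n"] pos unfolding gap by blast
  have step: "composite (bond b) (Suc (t n)) (Suc (t (Suc n)) - Suc (t n)) = arrow (\<kappa> (Suc n))" for n
  proof -
    have "Suc (t (Suc n)) - Suc (t n) = Suc (gap n)" using gap[of n] by simp
    moreover have "bond b (t (Suc n)) = arrow (\<kappa> (Suc n))"
      using pos' by (simp add: bond_def b_t chain)
    ultimately show ?thesis
      using idle(2)[of n "gap n"] pos gap[of n] by simp
  qed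
  have T: "strict_mono (\<lambda>n. Suc (t n))" using t by (simp add: strict_mono_def)
  have "path_limit b homeomorphic ilim (\<lambda>n. V (domain (\<kappa> n))) (\<lambda>n. arrow (\<kappa> (Suc n)))"
    using ilim_cofinal[of "\<lambda>n. V (position b n)" "bond b", OF bond_cont bond_into T]
    unfolding path_limit_def step pos .
  then show ?thesis using b by blast
qed

end

section \<open>Coordinates on a family of metrizable compacta\<close>

text \<open>
  The distances to the points of a countable dense set are the coordinates of an embedding into
  \<open>nat \<Rightarrow> real\<close>: they separate points, and a continuous injection of a compact space into a
  Hausdorff space is an embedding.
\<close>

lemma metrizable_compactum_embeds:
  assumes "metrizable_compactum X"
  shows "\<exists>(K :: (nat \<Rightarrow> real) set) h k. compact K \<and> homeomorphic_maps X (top_of_set K) h k"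
proof -
  have cpt: "compact_space X" and "metrizable_space X"
    using assms by (auto simp: metrizable_compactum_def)
  then obtain M d where Md: "Metric_space M d" and X: "X = Metric_space.mtopology M d"
    by (auto simp: metrizable_space_def)
  interpret Metric_space M d by (rule Md)
  have top: "topspace X = M" by (simp add: X)
  have "mtotally_bounded M"
    using cpt compactin_imp_mtotally_bounded unfolding X compact_space_def by simp
  then have "\<exists>K. finite K \<and> K \<subseteq> M \<and> M \<subseteq> (\<Union>x\<in>K. mball x (1 / real (Suc n)))" for n
    unfolding mtotally_bounded_def by (metis of_nat_0_less_iff zero_less_Suc zero_less_divide_1_iff)
  then obtain N where N: "\<And>n. finite (N n)" "\<And>n. N n \<subseteq> M"
      "\<And>n. M \<subseteq> (\<Union>x\<in>N n. mball x (1 / real (Suc n)))"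
    by metis
  \<comment> \<open>The union of finite \<open>1 / Suc n\<close>-nets is a countable dense set.\<close>
  define S where "S = (\<Union>n. N n)"
  have cS: "countable S" and SM: "S \<subseteq> M"
    unfolding S_def using N by (auto intro: countable_finite)
  \<comment> \<open>The set \<open>S\<close> is empty if \<open>X\<close> is; then \<open>from_nat_into S n\<close> need not be a point of \<open>X\<close>.\<close>
  define h where "h = (\<lambda>x n. if S = {} then 0 else d (from_nat_into S n) x)"
  have inj: "inj_on h M"
  proof (rule inj_onI, rule ccontr)
    fix x y assume x: "x \<in> M" and y: "y \<in> M" and eq: "h x = h y" and ne: "x \<noteq> y"
    then have "d x y > 0" by simp
    then obtain n where n: "1 / real (Suc n) < d x y / 2"
      by (metis half_gt_zero nat_approx_posE)
    obtain s where s: "s \<in> N n" "d s x < 1 / real (Suc n)" "s \<in> M"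
      using N(3)[of n] x by auto
    then have "s \<in> S" by (auto simp: S_def)
    then obtain m where "from_nat_into S m = s"
      using from_nat_into_surj[OF cS] by blast
    then have "d s x = d s y" using fun_cong[OF eq, of m] \<open>s \<in> S\<close> by (auto simp: h_def split: if_splits)
    moreover have "d x y \<le> d s x + d s y" using triangle'' x y s by blast
    ultimately show False using s n by linarith
  qed
  have "continuous_map X euclidean (\<lambda>x. h x n)" for n
  proof (cases "S = {}")
    case False
    then have "from_nat_into S n \<in> M" using SM by (meson from_nat_into subsetD)
    then show ?thesis
      using continuous_on_mdist[of "from_nat_into S n" "metric (M, d)"] False
      by (simp add: h_def X)
  qed (simp add: h_def)
  then have h: "continuous_map X euclidean h"
    using continuous_map_componentwise_UNIV[of X "\<lambda>_. euclideanreal" h]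
    unfolding euclidean_product_topology by simp
  have "homeomorphic_map X (top_of_set (h ` M)) h"
    using h cpt inj by (intro continuous_imp_homeomorphic_map)
      (auto simp: top continuous_map_in_subtopology Hausdorff_space_subtopology)
  moreover have "compact (h ` M)"
    using image_compactin[OF _ h, of M] cpt
    by (simp add: compact_space_def top compactin_euclidean_iff)
  ultimately show ?thesis
    using homeomorphic_map_maps by blast
qed

text \<open>
  Members of \<open>P\<close>, enumerated with possible repetitions, together with homeomorphisms onto subsets
  of \<open>nat \<Rightarrow> real\<close>.
\<close>

locale coordinatized_family =
  fixes P :: "'a topology set" and W :: "nat \<Rightarrow> 'a topology"
    and V :: "nat \<Rightarrow> (nat \<Rightarrow> real) set"
    and h :: "nat \<Rightarrow> 'a \<Rightarrow> (nat \<Rightarrow> real)" and k :: "nat \<Rightarrow> (nat \<Rightarrow> real) \<Rightarrow> 'a"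
  assumes W: "W v \<in> P"
    and hk: "homeomorphic_maps (W v) (top_of_set (V v)) (h v) (k v)"
begin

lemma h: "continuous_map (W v) (top_of_set (V v)) (h v)"
  and k: "continuous_map (top_of_set (V v)) (W v) (k v)"
  and kh: "x \<in> topspace (W v) \<Longrightarrow> k v (h v x) = x"
  and hk': "y \<in> V v \<Longrightarrow> h v (k v y) = y"
  using hk[of v] by (auto simp: homeomorphic_maps_def)

lemma h_image: "h v ` topspace (W v) = V v"
  and k_image: "k v ` V v = topspace (W v)"
  using homeomorphic_imp_surjective_map[of "W v" "top_of_set (V v)" "h v"]
    homeomorphic_imp_surjective_map[of "top_of_set (V v)" "W v" "k v"] hk[of v]
    homeomorphic_maps_map by fastforce+

lemma P_like_path:
  assumes f: "\<And>n. continuous_on (V (i (Suc n))) (f n)" "\<And>n. f n ` V (i (Suc n)) = V (i n)"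
  shows "P_like P (top_of_set (ilim (\<lambda>n. V (i n)) f))"
proof -
  define F where "F = (\<lambda>n. k (i n) \<circ> f n \<circ> h (i (Suc n)))"
  have img: "F n ` topspace (W (i (Suc n))) = topspace (W (i n))" for n
    unfolding F_def image_comp[symmetric] by (simp only: h_image f k_image)
  have "continuous_map (top_of_set (V (i (Suc n)))) (top_of_set (V (i n))) (f n)" for n
    unfolding continuous_map_in_subtopology continuous_map_iff_continuous using f[of n] by auto
  then have "inverse_sequence (\<lambda>n. W (i n)) F"
    unfolding inverse_sequence_def F_def using h k by (blast intro: continuous_map_compose)
  moreover have "inverse_limit (\<lambda>n. W (i n)) F homeomorphic_space
      inverse_limit (\<lambda>n. top_of_set (V (i n))) f"
  proof (rule inverse_limit_homeomorphic_levelwise)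
    show "homeomorphic_maps (W (i n)) (top_of_set (V (i n))) (h (i n)) (k (i n))" for n by (rule hk)
    show "F n ` topspace (W (i (Suc n))) \<subseteq> topspace (W (i n))" for n by (simp only: img)
    show "h (i n) (F n x) = f n (h (i (Suc n)) x)" if "x \<in> topspace (W (i (Suc n)))" for n x
    proof -
      have "h (i (Suc n)) x \<in> V (i (Suc n))" using h_image that by blast
      then have "f n (h (i (Suc n)) x) \<in> V (i n)" using f(2)[of n] by blast
      then show ?thesis by (simp add: F_def hk')
    qed
  qed
  ultimately show ?thesis
    unfolding P_like_def inverse_limit_top_of_set
    using W img homeomorphic_space_sym by blast
qed

text \<open>
  The indices are successors because the vertex \<open>0\<close> will be the auxiliary starting point, while
  the other vertices exhaust \<open>P\<close>.
\<close>

lemma P_like_imp_path: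
  assumes Y: "P_like P Y" and j: "\<And>X. X \<in> P \<Longrightarrow> \<exists>j. X = W (Suc j)"
  shows "\<exists>i f. (\<forall>n. continuous_on (V (Suc (i (Suc n)))) (f n)) \<and>
      (\<forall>n. f n ` V (Suc (i (Suc n))) = V (Suc (i n))) \<and>
      Y homeomorphic_space top_of_set (ilim (\<lambda>n. V (Suc (i n))) f)"
proof -
  obtain X F where XF: "inverse_sequence X F" "\<forall>n. X n \<in> P"
    "\<forall>n. F n ` topspace (X (Suc n)) = topspace (X n)" "Y homeomorphic_space inverse_limit X F"
    using Y unfolding P_like_def by auto
  have "\<forall>n. \<exists>j. X n = W (Suc j)" using j XF(2) by blast
  then obtain i where "\<forall>n. X n = W (Suc (i n))" by metis
  then have X: "X = (\<lambda>n. W (Suc (i n)))" by (intro ext) simp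
  define f where "f = (\<lambda>n. h (Suc (i n)) \<circ> F n \<circ> k (Suc (i (Suc n))))"
  have img: "f n ` V (Suc (i (Suc n))) = V (Suc (i n))" for n
    using spec[OF XF(3), of n] unfolding f_def image_comp[symmetric] X by (simp only: h_image k_image)
  have "continuous_map (W (Suc (i (Suc n)))) (W (Suc (i n))) (F n)" for n
    using XF(1) by (simp add: X inverse_sequence_def)
  then have "continuous_map (top_of_set (V (Suc (i (Suc n))))) (top_of_set (V (Suc (i n)))) (f n)" for n
    unfolding f_def using h k by (blast intro: continuous_map_compose)
  then have cont: "continuous_on (V (Suc (i (Suc n)))) (f n)" for n
    unfolding continuous_map_in_subtopology continuous_map_iff_continuous by blast
  have "inverse_limit X F homeomorphic_space inverse_limit (\<lambda>n. top_of_set (V (Suc (i n)))) f"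
    unfolding X
  proof (rule inverse_limit_homeomorphic_levelwise)
    show "homeomorphic_maps (W (Suc (i n))) (top_of_set (V (Suc (i n)))) (h (Suc (i n))) (k (Suc (i n)))" for n
      by (rule hk)
    show "F n ` topspace (W (Suc (i (Suc n)))) \<subseteq> topspace (W (Suc (i n)))" for n
      using spec[OF XF(3), of n] by (simp add: X)
    show "h (Suc (i n)) (F n x) = f n (h (Suc (i (Suc n))) x)"
      if "x \<in> topspace (W (Suc (i (Suc n))))" for n x
      using that by (simp add: f_def kh)
  qed
  then show ?thesis
    using XF(4) cont img homeomorphic_space_trans unfolding inverse_limit_top_of_set by blast
qed

end

section \<open>Compactifiability of limits over a countable family\<close>

definition surjections :: "'p::topological_space set \<Rightarrow> 'p set \<Rightarrow> ('p \<Rightarrow> 'p) set" where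
  "surjections K L = {f. continuous_on K f \<and> f ` K = L}"

theorem corollary5p8:
  fixes P :: "'a topology set"
  assumes "countable P"
    and "\<And>X. X \<in> P \<Longrightarrow> metrizable_compactum X"
  shows "compactifiable (P_like_spaces P)"
proof (cases "P = {}")
  case True
  define E where "E = (top_of_set {} :: real topology)"
  have "metrizable_compactum E"
    by (simp add: E_def metrizable_compactum_def metrizable_space_subtopology
        metrizable_space_euclidean compact_space_subtopology)
  moreover have "P_like_spaces P = {}"
    by (auto simp: True P_like_spaces_def P_like_def)
  ultimately show ?thesis
    by (intro compactifiableI[of E E id]) (auto simp: equivalent_classes_def fibers_def E_def)
next
  case False
  \<comment> \<open>The starting point \<open>X0\<close> may be empty only if all members of \<open>P\<close> are, as
    every member of \<open>P\<close> has to be mapped to it.\<close>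
  have "\<exists>X0\<in>P. \<forall>X\<in>P. topspace X \<noteq> {} \<longrightarrow> topspace X0 \<noteq> {}"
    using False by blast
  then obtain X0 where X0: "X0 \<in> P" "\<And>X. X \<in> P \<Longrightarrow> topspace X \<noteq> {} \<Longrightarrow> topspace X0 \<noteq> {}"
    by blast
  define W where "W = (\<lambda>v. case v of 0 \<Rightarrow> X0 | Suc j \<Rightarrow> from_nat_into P j)"
  have W: "W v \<in> P" for v
    using X0(1) from_nat_into[OF False] by (auto simp: W_def split: nat.split)
  have W_Suc: "\<exists>j. X = W (Suc j)" if "X \<in> P" for X
    using from_nat_into_surj[OF assms(1) that] by (auto simp: W_def)
  have "\<forall>v. \<exists>(K :: (nat \<Rightarrow> real) set) h k. compact K \<and> homeomorphic_maps (W v) (top_of_set K) h k"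
    using metrizable_compactum_embeds assms(2) W by blast
  then obtain V :: "nat \<Rightarrow> (nat \<Rightarrow> real) set" and h k where
    V: "\<And>v. compact (V v)" and hk: "\<And>v. homeomorphic_maps (W v) (top_of_set (V v)) (h v) (k v)"
    by metis
  interpret coordinatized_family P W V h k
    by unfold_locales (rule W, rule hk)
  have "V 0 \<noteq> {}" if "V v \<noteq> {}" for v
    using X0(2)[OF W[of v]] that unfolding h_image[symmetric] by (auto simp: W_def)
  then obtain p where p: "\<And>v x. x \<in> V v \<Longrightarrow> p \<in> V 0" by (metis ex_in_conv)
  have "\<exists>D\<subseteq>surjections (V v) (V w). countable D \<and>
      (\<forall>f\<in>surjections (V v) (V w). \<forall>e>0. \<exists>g\<in>D. \<forall>x\<in>V v. dist (f x) (g x) < e)" for v w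
    by (rule countable_uniformly_dense_subset[OF V[of v] V[of w]]) (auto simp: surjections_def)
  then obtain D where D: "\<And>v w. D v w \<subseteq> surjections (V v) (V w)" "\<And>v w. countable (D v w)"
    "\<And>v w f e. f \<in> surjections (V v) (V w) \<Longrightarrow> e > 0 \<Longrightarrow> \<exists>g\<in>D v w. \<forall>x\<in>V v. dist (f x) (g x) < e"
    by metis
  \<comment> \<open>The vertex \<open>0\<close> can be left by a constant map from any member of \<open>P\<close>; afterwards the
    arrows are surjections from the countable dense sets.\<close>
  define arrows where "arrows = {(0, 0, id)} \<union> (\<Union>v. {(0, Suc v, \<lambda>_. p)}) \<union>
    (\<Union>v. \<Union>w. (\<lambda>g. (Suc w, Suc v, g)) ` D (Suc v) (Suc w))"
  have "countable arrows"
    unfolding arrows_def using D(2) by auto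
  \<comment> \<open>The identity loop at the vertex \<open>0\<close> has index \<open>0\<close>, the only admissible one at time
    \<open>0\<close>.\<close>
  define e where "e = (\<lambda>m. case m of 0 \<Rightarrow> (0, 0, id) | Suc m \<Rightarrow> from_nat_into arrows m)"
  have e0: "e 0 = (0, 0, id)" by (simp add: e_def)
  have "arrows \<noteq> {}" by (simp add: arrows_def)
  then have e: "e m \<in> arrows" for m
    using from_nat_into[of arrows] by (auto simp: e_def arrows_def split: nat.split)
  have e_surj: "\<exists>m. e m = a" if a: "a \<in> arrows" for a
  proof -
    obtain m where "from_nat_into arrows m = a"
      using from_nat_into_surj[OF \<open>countable arrows\<close> a] by blast
    then have "e (Suc m) = a" by (simp add: e_def)
    then show ?thesis by blast
  qed
  define codom where "codom = (\<lambda>m. fst (e m))"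
  define domain where "domain = (\<lambda>m. fst (snd (e m)))"
  define arrow where "arrow = (\<lambda>m. snd (snd (e m)))"
  have arrow_cases: "(codom m = 0 \<and> domain m = 0 \<and> arrow m = id) \<or>
      (codom m = 0 \<and> domain m \<noteq> 0 \<and> arrow m = (\<lambda>_. p)) \<or>
      (codom m \<noteq> 0 \<and> domain m \<noteq> 0 \<and> arrow m \<in> surjections (V (domain m)) (V (codom m)))" for m
  proof -
    obtain a b c where abc: "e m = (a, b, c)" by (cases "e m")
    show ?thesis
      using e[of m] D(1) unfolding arrows_def codom_def domain_def arrow_def abc by auto
  qed
  interpret arrow_system V codom domain arrow
  proof
    show "compact (V v)" for v by (rule V)
    show "continuous_on (V (domain m)) (arrow m)" for m
      using arrow_cases[of m] by (auto simp: surjections_def id_def)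
    show "arrow m ` V (domain m) \<subseteq> V (codom m)" for m
      using arrow_cases[of m] p by (auto simp: surjections_def)
  qed
  show ?thesis
  proof (rule compactifiable_path_limits)
    fix b assume "b \<in> schedules"
    have leave: "position b (Suc n) \<noteq> 0 \<and> bond b n ` V (position b (Suc n)) = V (position b n)"
      if "position b n \<noteq> 0" for n
      using arrow_cases[of "b n"] that by (auto simp: bond_def surjections_def)
    have stay: "bond b n = id" if "position b n = 0" "position b (Suc n) = 0" for n
      using arrow_cases[of "b n"] that by (auto simp: bond_def split: if_splits)
    have "P_like P (top_of_set (path_limit b))"
    proof (cases "\<forall>n. position b n = 0")
      case True
      then show ?thesis
        unfolding path_limit_def
        by (intro P_like_path bond_cont) (use stay in \<open>simp del: position.simps\<close>)
    next
      case False
      then obtain N where "position b N \<noteq> 0" by blast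
      then have N: "position b (N + n) \<noteq> 0" for n
        by (induction n) (use leave in auto)
      \<comment> \<open>The bonding maps from time \<open>N\<close> on are surjective. The possibly constant map before
        it does not matter for the limit.\<close>
      have "path_limit b homeomorphic
          ilim (\<lambda>n. V (position b (N + n))) (\<lambda>n. composite (bond b) (N + n) (N + Suc n - (N + n)))"
        unfolding path_limit_def
        by (rule ilim_cofinal[of "\<lambda>n. V (position b n)" "bond b", OF bond_cont bond_into])
          (simp add: strict_mono_def)
      also have "(\<lambda>n. composite (bond b) (N + n) (N + Suc n - (N + n))) = (\<lambda>n. bond b (N + n))"
        by simp
      finally have "top_of_set (path_limit b) homeomorphic_space
          top_of_set (ilim (\<lambda>n. V (position b (N + n))) (\<lambda>n. bond b (N + n)))"
        by (rule homeomorphic_imp_homeomorphic_space)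
      moreover have "P_like P (top_of_set (ilim (\<lambda>n. V (position b (N + n))) (\<lambda>n. bond b (N + n))))"
      proof (rule P_like_path[of "\<lambda>n. position b (N + n)"])
        show "continuous_on (V (position b (N + Suc n))) (bond b (N + n))" for n
          using bond_cont[of b "N + n"] unfolding add_Suc_right .
        show "bond b (N + n) ` V (position b (N + Suc n)) = V (position b (N + n))" for n
          using leave[OF N[of n]] unfolding add_Suc_right by blast
      qed
      ultimately show ?thesis
        unfolding P_like_def by (meson homeomorphic_space_trans)
    qed
    then show "\<exists>Y\<in>P_like_spaces P. top_of_set (path_limit b) homeomorphic_space Y"
      using P_like_copy[of P "top_of_set (path_limit b)"] by blast
  next
    fix Y assume "Y \<in> P_like_spaces P"
    then have "P_like P Y" by (simp add: P_like_spaces_def)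
    then obtain i f where f: "\<forall>n. continuous_on (V (Suc (i (Suc n)))) (f n)"
        "\<forall>n. f n ` V (Suc (i (Suc n))) = V (Suc (i n))"
      and Y: "Y homeomorphic_space top_of_set (ilim (\<lambda>n. V (Suc (i n))) f)"
      using P_like_imp_path[of Y, OF _ W_Suc] by blast
    have "\<exists>g. (\<forall>n. g n \<in> D (Suc (i (Suc n))) (Suc (i n))) \<and>
        ilim (\<lambda>n. V (Suc (i n))) f homeomorphic ilim (\<lambda>n. V (Suc (i n))) g"
    proof (rule inverse_limit_approximation)
      fix n g assume "g \<in> D (Suc (i (Suc n))) (Suc (i n))"
      then show "continuous_on (V (Suc (i (Suc n)))) g" "g ` V (Suc (i (Suc n))) \<subseteq> V (Suc (i n))"
        using D(1)[of "Suc (i (Suc n))" "Suc (i n)"] unfolding surjections_def by blast+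
    next
      fix n and \<epsilon> :: real assume "\<epsilon> > 0"
      then show "\<exists>g\<in>D (Suc (i (Suc n))) (Suc (i n)). \<forall>x\<in>V (Suc (i (Suc n))). dist (f n x) (g x) < \<epsilon>"
        using f by (intro D(3)) (auto simp: surjections_def)
    qed (use V f in auto)
    then obtain g where g: "\<forall>n. g n \<in> D (Suc (i (Suc n))) (Suc (i n))"
      and fg: "ilim (\<lambda>n. V (Suc (i n))) f homeomorphic ilim (\<lambda>n. V (Suc (i n))) g"
      by blast
    \<comment> \<open>The path from the vertex \<open>0\<close> that starts with a constant map and then follows \<open>g\<close>.\<close>
    define a where "a = (\<lambda>n. case n of 0 \<Rightarrow> (0, Suc (i 0), \<lambda>_. p)
      | Suc n \<Rightarrow> (Suc (i n), Suc (i (Suc n)), g n))"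
    have "a n \<in> arrows" for n
      using g by (cases n) (auto simp: a_def arrows_def)
    then have "\<forall>n. \<exists>m. e m = a n" using e_surj by blast
    then obtain \<kappa> where \<kappa>: "\<And>n. e (\<kappa> n) = a n" by metis
    have dom: "domain (\<kappa> n) = Suc (i n)" for n
      by (simp add: domain_def \<kappa> a_def split: nat.split)
    have "\<exists>b\<in>schedules. path_limit b homeomorphic
        ilim (\<lambda>n. V (domain (\<kappa> n))) (\<lambda>n. arrow (\<kappa> (Suc n)))"
    proof (rule path_realizable)
      show "codom 0 = 0" "domain 0 = 0" "arrow 0 = id"
        by (simp_all add: codom_def domain_def arrow_def e0)
      show "codom (\<kappa> 0) = 0" by (simp add: codom_def \<kappa> a_def)
      show "codom (\<kappa> (Suc n)) = domain (\<kappa> n)" "domain (\<kappa> n) \<noteq> 0" for n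
        unfolding dom by (simp_all add: codom_def \<kappa> a_def)
    qed
    moreover have "(\<lambda>n. arrow (\<kappa> (Suc n))) = g"
      by (simp add: arrow_def \<kappa> a_def)
    ultimately obtain b where b: "b \<in> schedules"
        "path_limit b homeomorphic ilim (\<lambda>n. V (Suc (i n))) g"
      unfolding dom by auto
    have "ilim (\<lambda>n. V (Suc (i n))) f homeomorphic path_limit b"
      using fg b(2) by (meson homeomorphic_sym homeomorphic_trans)
    then show "\<exists>b\<in>schedules. Y homeomorphic_space top_of_set (path_limit b)"
      using b(1) Y by (meson homeomorphic_imp_homeomorphic_space homeomorphic_space_trans)
  qed
qed

end
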